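(* Let $k$ be a positive integer. For every integer $n\ge \frac{9}{2}k^2+\frac{13}{4}k+\frac{49}{32}$, $$(k-1)n-(k-1)^2\le \mathrm{lbal}(n,C_{4k})=\mathrm{bal}(n,C_{4k})<(k-1)n+12k^2+3k.$$
   Context: $C_\ell$ is the cycle on $\ell$ vertices. A 2-coloring of the edges of $K_n$ is a partition $E(K_n)=R\sqcup B$ (red edges and blue edges). A 2-list coloring of the edges of $K_n$ is a function $L:E(K_n)\to\{\{r\},\{b\},\{r,b\}\}$; it induces color classes $R=\{e: r\in L(e)\}$ and $B=\{e: b\in L(e)\}$ (which may intersect). Given a 2-coloring or a 2-list coloring with color classes $R,B$, a balanced copy of a graph $G=G(V,E)$ is a (not necessarily induced) copy of $G$ in $K_n$ whose edge set has a partition $E_1\sqcup E_2$ with $E_1\subseteq R$, $E_2\subseteq B$ and $\bigl||E_1|-|E_2|\bigr|\le 1$. Balancing number: $\mathrm{bal}(n,G)$ is the smallest integer $k$ such that every 2-coloring $R\sqcup B$ of the edges of $K_n$ with $|R|,|B|>k$ contains a balanced copy of $G$, where the condition $|R|,|B|>k$ is required to be satisfiable by some 2-coloring, i.e. $2(k+1)\le\binom{n}{2}$. List balancing number: for $n\ge |V|$, $\mathrm{lbal}(n,G)$ is the smallest integer $k$ such that every 2-list coloring of the edges of $K_n$ with color classes satisfying $|R|,|B|>k$ contains a balanced copy of $G$. *)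

theory Defs
  imports Complex_Main
begin

text \<open>A simple graph is a pair (vertices, edges), each edge being a two-element vertex set.\<close>

type_synonym 'a sgraph = "'a set \<times> 'a set set"

abbreviation verts :: "'a sgraph \<Rightarrow> 'a set" where "verts \<equiv> fst"

abbreviation edges :: "'a sgraph \<Rightarrow> 'a set set" where "edges \<equiv> snd"

definition complete_graph :: "nat \<Rightarrow> nat sgraph" where
  "complete_graph n = ({..<n}, {e. e \<subseteq> {..<n} \<and> card e = 2})"

text \<open>This is the cycle on \<open>l\<close> vertices only for \<open>l \<ge> 3\<close>.\<close>

definition cycle_graph :: "nat \<Rightarrow> nat sgraph" where
  "cycle_graph l = ({..<l}, {{i, Suc i mod l} | i. i < l})"

definition copies :: "'a sgraph \<Rightarrow> 'b sgraph \<Rightarrow> 'b sgraph set" where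
  "copies G H = {(f ` verts G, (`) f ` edges G) | f.
     inj_on f (verts G) \<and> f ` verts G \<subseteq> verts H \<and> (`) f ` edges G \<subseteq> edges H}"

definition balanced :: "'b set set \<Rightarrow> 'b set set \<Rightarrow> 'b sgraph \<Rightarrow> bool" where
  "balanced R B C \<longleftrightarrow> (\<exists>E1 E2. E1 \<union> E2 = edges C \<and> E1 \<inter> E2 = {} \<and> E1 \<subseteq> R \<and> E2 \<subseteq> B \<and>
     \<bar>int (card E1) - int (card E2)\<bar> \<le> 1)"

definition has_balanced_copy :: "nat \<Rightarrow> 'a sgraph \<Rightarrow> nat set set \<Rightarrow> nat set set \<Rightarrow> bool" where
  "has_balanced_copy n G R B \<longleftrightarrow> (\<exists>C \<in> copies G (complete_graph n). balanced R B C)"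

definition two_coloring :: "nat \<Rightarrow> nat set set \<Rightarrow> nat set set \<Rightarrow> bool" where
  "two_coloring n R B \<longleftrightarrow> R \<union> B = edges (complete_graph n) \<and> R \<inter> B = {}"

datatype color = Red | Blue

definition two_list_coloring :: "nat \<Rightarrow> (nat set \<Rightarrow> color set) \<Rightarrow> bool" where
  "two_list_coloring n L \<longleftrightarrow>
     (\<forall>e \<in> edges (complete_graph n). L e \<in> {{Red}, {Blue}, {Red, Blue}})"

definition color_class :: "nat \<Rightarrow> (nat set \<Rightarrow> color set) \<Rightarrow> color \<Rightarrow> nat set set" where
  "color_class n L c = {e \<in> edges (complete_graph n). c \<in> L e}"

definition bal_threshold :: "nat \<Rightarrow> 'a sgraph \<Rightarrow> int \<Rightarrow> bool" where
  "bal_threshold n G m \<longleftrightarrow> 2 * (m + 1) \<le> int (n choose 2) \<and>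
     (\<forall>R B. two_coloring n R B \<and> int (card R) > m \<and> int (card B) > m \<longrightarrow>
        has_balanced_copy n G R B)"

definition lbal_threshold :: "nat \<Rightarrow> 'a sgraph \<Rightarrow> int \<Rightarrow> bool" where
  "lbal_threshold n G m \<longleftrightarrow>
     (\<forall>L. two_list_coloring n L \<and>
        int (card (color_class n L Red)) > m \<and> int (card (color_class n L Blue)) > m \<longrightarrow>
        has_balanced_copy n G (color_class n L Red) (color_class n L Blue))"

text \<open>
  The threshold predicates need not have a least element, in which case \<open>LEAST\<close> is an
  unspecified integer. Hence \<open>bal\<close> and \<open>lbal\<close> are only meaningful together with
  \<open>bal_exists\<close> and \<open>lbal_exists\<close>.
\<close>

definition bal :: "nat \<Rightarrow> 'a sgraph \<Rightarrow> int" where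
  "bal n G = (LEAST m. bal_threshold n G m)"

definition lbal :: "nat \<Rightarrow> 'a sgraph \<Rightarrow> int" where
  "lbal n G = (LEAST m. lbal_threshold n G m)"

definition bal_exists :: "nat \<Rightarrow> 'a sgraph \<Rightarrow> bool" where
  "bal_exists n G \<longleftrightarrow>
     (\<exists>m. bal_threshold n G m \<and> (\<forall>m'. bal_threshold n G m' \<longrightarrow> m \<le> m'))"

definition lbal_exists :: "nat \<Rightarrow> 'a sgraph \<Rightarrow> bool" where
  "lbal_exists n G \<longleftrightarrow> card (verts G) \<le> n \<and>
     (\<exists>m. lbal_threshold n G m \<and> (\<forall>m'. lbal_threshold n G m' \<longrightarrow> m \<le> m'))"

end

theory Submission
  imports Defs
begin

text \<open>
  Upper bound. Consider the \<open>4k\<close>-cycles up to replacing one vertex by an unused one; such a step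
  changes the number of red edges by at most two, and any two cycles are connected by such steps.
  A parity argument shows that if no cycle has exactly \<open>2k\<close> red edges, then no step jumps from
  \<open>2k - 1\<close> to \<open>2k + 1\<close>, so all cycles lie on the same side of \<open>2k\<close>. On the other hand a color class
  with at least \<open>(k - 1) n + 12 k\<^sup>2\<close> edges contains half of the edges of some \<open>4k\<close>-cycle: either
  there are \<open>k\<close> vertices of degree at least \<open>3k - 1\<close>, which are centers of disjoint paths with two
  edges, or deleting the fewer than \<open>k\<close> such vertices leaves a graph of small maximum degree with
  a matching of size \<open>2k\<close>.

  Lower bound. Color red the edges between \<open>k - 1\<close> vertices and the rest; a cycle has at most
  \<open>2 (k - 1)\<close> edges at these vertices.
\<close>

section \<open>Counting red edges along a cyclic sequence of vertices\<close>

definition red_count :: "'a set set \<Rightarrow> nat \<Rightarrow> (nat \<Rightarrow> 'a) \<Rightarrow> nat" where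
  "red_count R l f = (\<Sum>i<l. of_bool ({f i, f (Suc i mod l)} \<in> R))"

definition cyc_pred :: "nat \<Rightarrow> nat \<Rightarrow> nat" where
  "cyc_pred l i = (if i = 0 then l - 1 else i - 1)"

text \<open>The vertex \<open>w\<close> is a separate argument so that, with the neighbors of
  position \<open>i\<close> fixed, the same function measures the present vertex \<open>f i\<close>
  and any candidate to replace it.\<close>

definition red_at :: "'a set set \<Rightarrow> nat \<Rightarrow> (nat \<Rightarrow> 'a) \<Rightarrow> nat \<Rightarrow> 'a \<Rightarrow> nat" where
  "red_at R l f i w =
    of_bool ({f (cyc_pred l i), w} \<in> R) + of_bool ({w, f (Suc i mod l)} \<in> R)"

lemma Suc_mod_eq: "i < l \<Longrightarrow> Suc i mod l = (if Suc i = l then 0 else Suc i)"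
  by auto

lemma red_at_le: "red_at R l f i w \<le> 2"
  by (simp add: red_at_def)

text \<open>Only the edges starting at \<open>i\<close> and at its predecessor involve position
  \<open>i\<close>, and all other terms cancel. The additive form avoids truncated subtraction on
  naturals.\<close>

lemma red_count_update:
  assumes "2 \<le> l" "i < l"
  shows "red_count R l (f(i := w)) + red_at R l f i (f i) = red_count R l f + red_at R l f i w"
proof -
  define p where "p = cyc_pred l i"
  have p: "p < l" "p \<noteq> i" "Suc p mod l = i" "Suc i mod l \<noteq> i"
    using assms by (auto simp: p_def cyc_pred_def Suc_mod_eq)
  have p_unique: "j = p" if "j < l" "Suc j mod l = i" for j
    using that assms by (auto simp: p_def cyc_pred_def Suc_mod_eq split: if_splits)
  have split: "(\<Sum>j<l. F j) = F i + F p + (\<Sum>j\<in>{..<l} - {i, p}. F j)" for F :: "nat \<Rightarrow> nat"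
  proof -
    have "sum F {..<l} = sum F {i, p} + sum F ({..<l} - {i, p})"
      using p assms by (subst add.commute, subst sum.subset_diff[of "{i, p}"]) auto
    then show ?thesis using p by auto
  qed
  have "(\<Sum>j\<in>{..<l} - {i, p}. of_bool ({(f(i := w)) j, (f(i := w)) (Suc j mod l)} \<in> R) :: nat)
    = (\<Sum>j\<in>{..<l} - {i, p}. of_bool ({f j, f (Suc j mod l)} \<in> R))"
    using p_unique by (intro sum.cong) auto
  then show ?thesis
    using p unfolding red_count_def split red_at_def p_def[symmetric] by simp
qed

text \<open>For even \<open>l\<close> the wrap-around step also switches parity, so both neighbor
  maps exchange even and odd positions.\<close>

lemma parity_shift_bij:
  assumes "even l"
  shows "bij_betw (\<lambda>i. Suc i mod l) {i. i < l \<and> even i = b} {i. i < l \<and> even i \<noteq> b}"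
    and "bij_betw (cyc_pred l) {i. i < l \<and> even i = b} {i. i < l \<and> even i \<noteq> b}"
proof -
  have nxt: "Suc i mod l < l \<and> even (Suc i mod l) \<noteq> even i \<and> cyc_pred l (Suc i mod l) = i"
    if "i < l" for i
    using that assms by (auto simp: Suc_mod_eq cyc_pred_def)
  have prv: "cyc_pred l i < l \<and> even (cyc_pred l i) \<noteq> even i \<and> Suc (cyc_pred l i) mod l = i"
    if "i < l" for i
    using that assms by (auto simp: cyc_pred_def)
  show "bij_betw (\<lambda>i. Suc i mod l) {i. i < l \<and> even i = b} {i. i < l \<and> even i \<noteq> b}"
    by (rule bij_betw_byWitness[where f' = "cyc_pred l"]) (use nxt prv in auto)
  show "bij_betw (cyc_pred l) {i. i < l \<and> even i = b} {i. i < l \<and> even i \<noteq> b}"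
    by (rule bij_betw_byWitness[where f' = "\<lambda>i. Suc i mod l"]) (use nxt prv in auto)
qed

text \<open>In an even cycle every edge has exactly one end in the parity class \<open>Q b\<close>,
  so summing over this class meets each edge once. For a fixed \<open>w\<close>, each position of
  the other class occurs twice, once as predecessor and once as successor, whence the even
  total.\<close>

lemma sum_red_at:
  assumes "even l"
  defines "Q \<equiv> \<lambda>b. {i. i < l \<and> even i = b}"
  shows "(\<Sum>i\<in>Q b. red_at R l f i (f i)) = red_count R l f"
    and "even (\<Sum>i\<in>Q b. red_at R l f i w)"
proof -
  have "{i. i < l \<and> even i \<noteq> b} = Q (\<not> b)" by (auto simp: Q_def)
  then have bij: "bij_betw (\<lambda>i. Suc i mod l) (Q b) (Q (\<not> b))" "bij_betw (cyc_pred l) (Q b) (Q (\<not> b))"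
    using parity_shift_bij[OF assms(1), of b] by (simp_all add: Q_def)
  have nxt: "(\<Sum>i\<in>Q b. F (Suc i mod l)) = (\<Sum>i\<in>Q (\<not> b). F i)" for F :: "nat \<Rightarrow> nat"
    using bij(1) by (rule sum.reindex_bij_betw)
  have prv: "(\<Sum>i\<in>Q b. F (cyc_pred l i)) = (\<Sum>i\<in>Q (\<not> b). F i)" for F :: "nat \<Rightarrow> nat"
    using bij(2) by (rule sum.reindex_bij_betw)
  have "Suc (cyc_pred l i) mod l = i" if "i \<in> Q b" for i
    using that by (auto simp: Q_def cyc_pred_def)
  then have "(\<Sum>i\<in>Q b. of_bool ({f (cyc_pred l i), f i} \<in> R)) =
      (\<Sum>i\<in>Q b. of_bool ({f (cyc_pred l i), f (Suc (cyc_pred l i) mod l)} \<in> R) :: nat)"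
    by (intro sum.cong) auto
  also have "\<dots> = (\<Sum>i\<in>Q (\<not> b). of_bool ({f i, f (Suc i mod l)} \<in> R))"
    by (rule prv)
  finally have "(\<Sum>i\<in>Q b. red_at R l f i (f i)) =
      (\<Sum>i\<in>Q (\<not> b). of_bool ({f i, f (Suc i mod l)} \<in> R)) +
      (\<Sum>i\<in>Q b. of_bool ({f i, f (Suc i mod l)} \<in> R))"
    by (simp add: red_at_def sum.distrib)
  also have "\<dots> = (\<Sum>i\<in>Q (\<not> b) \<union> Q b. of_bool ({f i, f (Suc i mod l)} \<in> R))"
    by (rule sum.union_disjoint[symmetric]) (auto simp: Q_def)
  also have "Q (\<not> b) \<union> Q b = {..<l}" by (auto simp: Q_def)
  finally show "(\<Sum>i\<in>Q b. red_at R l f i (f i)) = red_count R l f"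
    by (simp add: red_count_def)
  have "(\<Sum>i\<in>Q b. red_at R l f i w) =
      (\<Sum>i\<in>Q (\<not> b). of_bool ({f i, w} \<in> R)) + (\<Sum>i\<in>Q (\<not> b). of_bool ({w, f i} \<in> R))"
    using prv[of "\<lambda>j. of_bool ({f j, w} \<in> R)"] nxt[of "\<lambda>j. of_bool ({w, f j} \<in> R)"]
    by (simp add: red_at_def sum.distrib)
  then show "even (\<Sum>i\<in>Q b. red_at R l f i w)"
    by (simp add: insert_commute)
qed

section \<open>Replacement moves between cycles\<close>

definition cycle_map :: "'a set \<Rightarrow> nat \<Rightarrow> (nat \<Rightarrow> 'a) \<Rightarrow> bool" where
  "cycle_map V l f \<longleftrightarrow> inj_on f {..<l} \<and> f ` {..<l} \<subseteq> V"

lemma cycle_map_update: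
  assumes "cycle_map V l f" "w \<in> V" "w \<notin> f ` {..<l}"
  shows "cycle_map V l (f(i := w))"
  using assms unfolding cycle_map_def inj_on_def by (auto simp: image_iff)

lemma exists_fresh:
  assumes "card V \<ge> l + 2" "finite V"
  shows "\<exists>w\<in>V. w \<notin> f ` {..<l} \<and> w \<noteq> u"
proof -
  have "card (insert u (f ` {..<l})) \<le> Suc (card (f ` {..<l}))"
    by (rule card_insert_le_m1) auto
  also have "\<dots> \<le> Suc l" using card_image_le[of "{..<l}" f] by simp
  finally have "card (insert u (f ` {..<l})) < card V" using assms by simp
  then have "\<not> V \<subseteq> insert u (f ` {..<l})"
    by (meson card_mono finite_imageI finite_insert finite_lessThan not_less)
  then show ?thesis by auto
qed

text \<open>A replacement jumping over \<open>t\<close> leads from \<open>t - 1\<close> to \<open>t + 1\<close>. A further vertex \<open>w\<close> may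
  then replace any vertex of the same parity class in either cycle, and each such replacement
  must change the number of red edges by an even amount. Summing over the class, the odd
  number \<open>t - 1\<close> would be congruent to twice the number of red edges from \<open>w\<close> to the other class.\<close>

lemma red_count_move:
  assumes "2 \<le> l" "even l" "even t" "finite V" "card V \<ge> l + 2"
    and avoid: "\<And>g. cycle_map V l g \<Longrightarrow> red_count R l g \<noteq> t"
    and f: "cycle_map V l f" and u: "u \<in> V" "u \<notin> f ` {..<l}" and p: "p < l"
    and less: "red_count R l f < t"
  shows "red_count R l (f(p := u)) < t"
proof (rule ccontr)
  assume not_less: "\<not> ?thesis"
  let ?f' = "f(p := u)"
  have f': "cycle_map V l ?f'" using f u by (rule cycle_map_update)
  then have gt: "red_count R l ?f' > t" using avoid not_less by (metis nat_neq_iff)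
  note upd = red_count_update[OF assms(1), of _ R]
  from upd[OF p, of f u] gt less red_at_le[of R l f p u]
  \<comment> \<open>A move adds at most two red edges, so passing over \<open>t\<close> forces a
    jump from \<open>t - 1\<close> to \<open>t + 1\<close>, with no red edge at the old
    vertex.\<close>
  have vals: "red_count R l f + 1 = t" "red_count R l ?f' = t + 1" "red_at R l f p (f p) = 0"
    by linarith+
  obtain w where w: "w \<in> V" "w \<notin> f ` {..<l}" "w \<noteq> u"
    using exists_fresh assms(4,5) by metis
  then have w': "w \<notin> ?f' ` {..<l}" by auto
  have "even (red_at R l f i (f i) + red_at R l f i w)" if i: "i < l" "even i = even p" for i
  proof -
    have "red_count R l (f(i := w)) \<noteq> t" using avoid cycle_map_update[OF f w(1,2)] by blast
    with upd[OF i(1), of f w] vals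
    have 1: "red_at R l f i w \<noteq> red_at R l f i (f i) + 1" by linarith
    show ?thesis
    proof (cases "i = p")
      case True
      \<comment> \<open>Here the old vertex contributes \<open>0\<close>, and the only odd
        contribution possible for \<open>w\<close>, namely \<open>1\<close>, would produce exactly
        \<open>t\<close> red edges.\<close>
      then show ?thesis using 1 vals(3) red_at_le[of R l f p w]
        by (metis One_nat_def add_0 add_cancel_right_left even_zero even_numeral le_SucE le_zero_eq
            numeral_2_eq_2)
    next
      case False
      have "red_count R l (?f'(i := w)) \<noteq> t"
        using avoid cycle_map_update[OF f' w(1) w'] by blast
      \<comment> \<open>The neighbors of \<open>i\<close> have the opposite parity to
        \<open>p\<close>, so the replacement at \<open>p\<close> is invisible from
        \<open>i\<close>.\<close>
      moreover have "red_at R l ?f' i v = red_at R l f i v" for v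
      proof -
        have "even (Suc i mod l) \<noteq> even i" "even (cyc_pred l i) \<noteq> even i"
          using i(1) assms(2) by (auto simp: Suc_mod_eq cyc_pred_def)
        then have "Suc i mod l \<noteq> p" "cyc_pred l i \<noteq> p" using i(2) by auto
        then show ?thesis by (simp add: red_at_def)
      qed
      \<comment> \<open>From \<open>f\<close>, with \<open>t - 1\<close> red edges, an increase by
        one is excluded; from \<open>?f'\<close>, with \<open>t + 1\<close>, a decrease by one is.
        Only even changes remain.\<close>
      ultimately have "red_at R l f i (f i) \<noteq> red_at R l f i w + 1"
        using upd[OF i(1), of ?f' w] vals False by auto
      moreover have "even (a + b)" if "a \<le> 2" "b \<le> 2" "b \<noteq> a + 1" "a \<noteq> b + 1" for a b :: nat
        using that by presburger
      ultimately show ?thesis using 1 red_at_le by metis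
    qed
  qed
  then have "even (\<Sum>i\<in>{i. i < l \<and> even i = even p}. red_at R l f i (f i) + red_at R l f i w)"
    by (intro dvd_sum) auto
  then have "even (red_count R l f)"
    using sum_red_at[OF assms(2), where b = "even p" and R = R and f = f] by (simp add: sum.distrib)
  then show False using vals(1) assms(3) by (metis even_plus_one_iff)
qed

text \<open>Induction on the number of positions where \<open>f\<close> and \<open>g\<close>
  disagree. One of them is corrected by at most two moves: evict \<open>g i\<close> from its current
  position if it is in use, then place it at \<open>i\<close>. The count stays below
  \<open>t\<close> throughout.\<close>

lemma red_count_connected:
  assumes "2 \<le> l" "even l" "even t" "finite V" "card V \<ge> l + 2"
    and avoid: "\<And>g. cycle_map V l g \<Longrightarrow> red_count R l g \<noteq> t"
    and g: "cycle_map V l g" and f: "cycle_map V l f" and less: "red_count R l f < t"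
  shows "red_count R l g < t"
  using f less
proof (induction "card {i. i < l \<and> f i \<noteq> g i}" arbitrary: f rule: less_induct)
  case less
  note move = red_count_move[OF assms(1-5) avoid]
  show ?case
  proof (cases "\<exists>i<l. f i \<noteq> g i")
    case False
    then have "red_count R l f = red_count R l g"
      unfolding red_count_def by (intro sum.cong) auto
    then show ?thesis using less.prems by simp
  next
    case True
    then obtain i where i: "i < l" "f i \<noteq> g i" by blast
    have giV: "g i \<in> V" using g i by (auto simp: cycle_map_def)
    obtain h where h: "cycle_map V l h" "red_count R l h < t" "g i \<notin> h ` {..<l}"
      "{j. j < l \<and> h j \<noteq> g j} \<subseteq> {j. j < l \<and> f j \<noteq> g j}"
    proof (cases "g i \<in> f ` {..<l}")
      case False
      then show ?thesis using that less.prems by blast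
    next
      case True
      then obtain j where j: "j < l" "g i = f j" by auto
      then have "j \<noteq> i" using i by auto
      \<comment> \<open>Position \<open>j\<close> was already wrong, so putting \<open>w\<close>
        there creates no new disagreement.\<close>
      then have "f j \<noteq> g j" using j i g by (auto simp: cycle_map_def inj_on_def)
      obtain w where w: "w \<in> V" "w \<notin> f ` {..<l}" "w \<noteq> g i"
        using exists_fresh assms(4,5) by metis
      show ?thesis
      proof (rule that[of "f(j := w)"])
        show "cycle_map V l (f(j := w))" using less.prems(1) w by (intro cycle_map_update)
        show "red_count R l (f(j := w)) < t" using move less.prems w j by blast
        show "g i \<notin> (f(j := w)) ` {..<l}"
          using less.prems(1) j w by (auto simp: cycle_map_def inj_on_def)
        show "{m. m < l \<and> (f(j := w)) m \<noteq> g m} \<subseteq> {j. j < l \<and> f j \<noteq> g j}"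
          using \<open>f j \<noteq> g j\<close> by auto
      qed
    qed
    have "{j. j < l \<and> (h(i := g i)) j \<noteq> g j} \<subset> {j. j < l \<and> f j \<noteq> g j}"
      using h(4) i by auto
    then have "card {j. j < l \<and> (h(i := g i)) j \<noteq> g j} < card {j. j < l \<and> f j \<noteq> g j}"
      by (intro psubset_card_mono) auto
    moreover have "cycle_map V l (h(i := g i))" using h giV by (intro cycle_map_update)
    moreover have "red_count R l (h(i := g i)) < t" using move h giV i by blast
    ultimately show ?thesis using less.hyps by blast
  qed
qed

section \<open>Cycles with many edges in a large color class\<close>

text \<open>Greedy choice: each set is at least as large as the whole index set, so the earlier
  choices never exhaust it.\<close>

lemma distinct_representatives:
  assumes "finite I" "\<And>i. i \<in> I \<Longrightarrow> finite (N i) \<and> card I \<le> card (N i)"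
  shows "\<exists>g. inj_on g I \<and> (\<forall>i\<in>I. g i \<in> N i)"
  using assms
proof (induction I rule: finite_induct)
  case (insert x I)
  then obtain g where g: "inj_on g I" "\<forall>i\<in>I. g i \<in> N i" by fastforce
  have "card (g ` I) < card (N x)"
    using insert.hyps insert.prems[of x] card_image_le[of I g] by auto
  then obtain y where y: "y \<in> N x" "y \<notin> g ` I"
    using insert.hyps by (meson card_mono finite_imageI not_less subsetI)
  have "inj_on (g(x := y)) (insert x I) \<and> (\<forall>i\<in>insert x I. (g(x := y)) i \<in> N i)"
    using g y insert.hyps by (auto simp: inj_on_def image_iff)
  then show ?case by blast
qed simp

lemma inj_on_extend:
  assumes "inj_on f S" "f ` S \<subseteq> V" "S \<subseteq> {..<l}" "finite V" "card V \<ge> l"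
  shows "\<exists>g. cycle_map V l g \<and> (\<forall>i\<in>S. g i = f i)"
proof -
  have S: "finite S" using assms(3) finite_subset by blast
  have "card ({..<l} - S) = l - card S" using assms(3) S by (simp add: card_Diff_subset)
  moreover have "card (V - f ` S) = card V - card S"
    using assms S by (simp add: card_Diff_subset card_image)
  ultimately have "card ({..<l} - S) \<le> card (V - f ` S)" using assms(5) by simp
  then obtain h where h: "inj_on h ({..<l} - S)" "\<forall>i\<in>{..<l} - S. h i \<in> V - f ` S"
    using distinct_representatives[of "{..<l} - S" "\<lambda>_. V - f ` S"] assms(4) by auto
  define g where "g = (\<lambda>i. if i \<in> S then f i else h i)"
  have "inj_on g {..<l}"
  proof (rule inj_onI)
    fix i j assume "i \<in> {..<l}" "j \<in> {..<l}" "g i = g j"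
    moreover have False if "i \<in> S" "j \<in> {..<l} - S" "f i = h j" for i j
      using h(2) that by (metis DiffD2 image_eqI)
    ultimately show "i = j"
      using assms(1) h(1) unfolding g_def inj_on_def
      by (metis DiffI)
  qed
  moreover have "g ` {..<l} \<subseteq> V" using assms(2) h(2) by (auto simp: g_def)
  ultimately show ?thesis by (intro exI[of _ g]) (auto simp: cycle_map_def g_def)
qed

text \<open>Greedy choice: the \<open>2 * m\<close> endpoints chosen so far meet at most
  \<open>2 * m * d\<close> edges, so some edge of \<open>F\<close> avoids them all. The matching is
  stored as consecutive pairs of positions, ready to be read as alternate edges of a cycle.\<close>

lemma matching_exists:
  assumes "finite F" "\<And>e. e \<in> F \<Longrightarrow> card e = 2 \<and> e \<subseteq> V"
    and "\<And>v. card {e \<in> F. v \<in> e} \<le> d" and "2 * d * m < card F"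
  shows "\<exists>f. cycle_map V (2 * m) f \<and> (\<forall>j<m. {f (2 * j), f (2 * j + 1)} \<in> F)"
  using assms(4)
proof (induction m)
  case 0
  then show ?case by (auto simp: cycle_map_def)
next
  case (Suc m)
  then obtain f where f: "cycle_map V (2 * m) f" "\<forall>j<m. {f (2 * j), f (2 * j + 1)} \<in> F"
    by fastforce
  let ?T = "\<Union>i<2 * m. {e \<in> F. f i \<in> e}"
  have "card ?T \<le> (\<Sum>i<2 * m. card {e \<in> F. f i \<in> e})" by (rule card_UN_le) simp
  also have "\<dots> \<le> (\<Sum>i<2 * m. d)" by (intro sum_mono assms(3))
  also have "\<dots> < card F" using Suc.prems by (simp add: algebra_simps)
  finally have "card ?T < card F" .
  moreover have "finite ?T" using assms(1) by simp
  ultimately have "\<not> F \<subseteq> ?T" using card_mono[of ?T F] by linarith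
  then obtain e where e: "e \<in> F" "\<forall>i<2 * m. f i \<notin> e" by auto
  obtain x y where xy: "e = {x, y}" "x \<noteq> y" using assms(2)[OF e(1)] by (meson card_2_iff)
  define g where "g = f(2 * m := x, Suc (2 * m) := y)"
  have old: "g i = f i" if "i < 2 * m" for i using that by (simp add: g_def)
  have new: "g (2 * m) = x" "g (Suc (2 * m)) = y" by (simp_all add: g_def)
  have set: "{..<2 * Suc m} = {..<2 * m} \<union> {2 * m, Suc (2 * m)}" by auto
  have "g ` {..<2 * m} = f ` {..<2 * m}" using old by auto
  then have "cycle_map V (2 * Suc m) g"
    using f(1) e xy new assms(2)[OF e(1)] old
    unfolding cycle_map_def set inj_on_def by (auto simp: image_iff)
  moreover have "{g (2 * j), g (2 * j + 1)} \<in> F" if "j < Suc m" for j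
    using that f(2) e xy new old[of "2 * j"] old[of "2 * j + 1"]
    by (cases "j = m") auto
  ultimately show ?case by blast
qed

lemma red_count_ge:
  assumes "S \<subseteq> {..<l}" "\<And>i. i \<in> S \<Longrightarrow> {f i, f (Suc i mod l)} \<in> R"
  shows "card S \<le> red_count R l f"
proof -
  have "card S = (\<Sum>i\<in>S. of_bool ({f i, f (Suc i mod l)} \<in> R))" using assms(2) by simp
  also have "\<dots> \<le> red_count R l f"
    unfolding red_count_def by (rule sum_mono2) (use assms(1) in auto)
  finally show ?thesis .
qed

lemma card_residue_class:
  assumes "0 < (c::nat)" "r < c"
  shows "card {i. i < c * k \<and> i mod c = r} = k"
proof -
  have "bij_betw (\<lambda>j. c * j + r) {..<k} {i. i < c * k \<and> i mod c = r}"
  proof (rule bij_betw_byWitness[where f' = "\<lambda>i. i div c"])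
    show "(\<lambda>j. c * j + r) ` {..<k} \<subseteq> {i. i < c * k \<and> i mod c = r}"
    proof clarsimp
      fix j assume "j < k"
      then have "c * Suc j \<le> c * k" by (intro mult_le_mono2) simp
      then show "c * j + r < c * k \<and> r mod c = r" using assms by simp
    qed
    show "(\<lambda>i. i div c) ` {i. i < c * k \<and> i mod c = r} \<subseteq> {..<k}"
      using assms by (auto simp: less_mult_imp_div_less mult.commute)
  qed (use assms in auto)
  then show ?thesis using bij_betw_same_card by fastforce
qed

text \<open>Each block of four positions holds one path with two edges: its center from
  \<open>A\<close> at residue 1, its leaves at residues 0 and 2, and an arbitrary filler at residue
  3. The \<open>k\<close> blocks give \<open>2 * k\<close> red edges.\<close>

lemma cherries_cycle:
  assumes "finite V" "card V \<ge> 4 * k" "\<And>e. e \<in> R \<Longrightarrow> card e = 2 \<and> e \<subseteq> V"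
    and A: "A \<subseteq> V" "card A = k" "\<And>v. v \<in> A \<Longrightarrow> 3 * k - 1 \<le> card {w. {v, w} \<in> R}"
  shows "\<exists>f. cycle_map V (4 * k) f \<and> 2 * k \<le> red_count R (4 * k) f"
proof -
  have finA: "finite A" using A(1) assms(1) finite_subset by blast
  obtain c where c: "bij_betw c {..<k} A"
    using A(2) finA ex_bij_betw_nat_finite[of A] by (metis atLeast0LessThan)
  let ?I = "\<lambda>r. {i. i < 4 * k \<and> i mod 4 = r}"
  let ?N = "\<lambda>v. {w. {v, w} \<in> R}"
  have div: "i div 4 < k" if "i < 4 * k" for i using that by auto
  have cA: "c (i div 4) \<in> A" if "i < 4 * k" for i
    using c div[OF that] by (auto simp: bij_betw_def)
  have nbr: "w \<in> V \<and> w \<noteq> v" if "{v, w} \<in> R" for v w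
    using assms(3)[OF that] by (auto simp: card_2_iff doubleton_eq_iff)
  have finN: "finite (?N v)" for v
    by (rule finite_subset[OF _ assms(1)]) (use nbr in auto)
  have size: "2 * k \<le> card (?N v - A)" if "v \<in> A" for v
  proof -
    \<comment> \<open>As \<open>v\<close> is not its own neighbor, removing \<open>A\<close> costs
      at most \<open>k - 1\<close> neighbors, which leaves
      \<open>(3 * k - 1) - (k - 1) = 2 * k\<close>, one for each leaf position.\<close>
    have "?N v - A = ?N v - (A - {v})" using nbr by auto
    then have "card (?N v - A) = card (?N v - (A - {v}))" by (rule arg_cong)
    moreover have "card (?N v) - card (A - {v}) \<le> card (?N v - (A - {v}))"
      using finA by (intro diff_card_le_card_Diff) auto
    moreover have "card (A - {v}) = k - 1" "k > 0" using that A(2) finA by (auto simp: card_gt_0_iff)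
    ultimately show ?thesis using A(3)[OF that] by linarith
  qed
  have "card (?I 0 \<union> ?I 2) = 2 * k"
    using card_residue_class[of 4 0 k] card_residue_class[of 4 2 k] by (subst card_Un_disjoint) auto
  then have "\<exists>g. inj_on g (?I 0 \<union> ?I 2) \<and> (\<forall>i\<in>?I 0 \<union> ?I 2. g i \<in> ?N (c (i div 4)) - A)"
    by (intro distinct_representatives) (use size cA finN in auto)
  then obtain g where g: "inj_on g (?I 0 \<union> ?I 2)"
      "\<forall>i\<in>?I 0 \<union> ?I 2. g i \<in> ?N (c (i div 4)) - A"
    by (elim exE conjE)
  have gR: "{c (i div 4), g i} \<in> R \<and> g i \<in> V \<and> g i \<notin> A" if "i \<in> ?I 0 \<union> ?I 2" for i
    using bspec[OF g(2) that] nbr[of "c (i div 4)" "g i"] by simp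
  define f where "f = (\<lambda>i. if i mod 4 = 1 then c (i div 4) else g i)"
  let ?S = "?I 0 \<union> ?I 1 \<union> ?I 2"
  have "inj_on f ?S"
  proof (rule inj_onI)
    fix i j assume ij: "i \<in> ?S" "j \<in> ?S" "f i = f j"
    have ne: False if "i < 4 * k" "j \<in> ?I 0 \<union> ?I 2" "c (i div 4) = g j" for i j
    proof -
      have "g j \<notin> A" using gR[OF that(2)] by simp
      then show False using that(3) cA[OF that(1)] by simp
    qed
    have centers: "i = j" if "i \<in> ?I 1" "j \<in> ?I 1" "c (i div 4) = c (j div 4)"
    proof -
      have "i div 4 = j div 4"
        using c that div unfolding bij_betw_def inj_on_def by auto
      moreover have "i mod 4 = j mod 4" using that by simp
      ultimately show ?thesis by (metis div_mult_mod_eq)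
    qed
    show "i = j"
    proof (cases "i mod 4 = 1"; cases "j mod 4 = 1")
      assume "i mod 4 = 1" "j mod 4 = 1"
      then show ?thesis using centers ij by (auto simp: f_def)
    next
      assume "i mod 4 = 1" "j mod 4 \<noteq> 1"
      then show ?thesis using ne[of i j] ij by (auto simp: f_def)
    next
      assume "i mod 4 \<noteq> 1" "j mod 4 = 1"
      then show ?thesis using ne[of j i] ij by (auto simp: f_def)
    next
      assume "i mod 4 \<noteq> 1" "j mod 4 \<noteq> 1"
      then show ?thesis using inj_onD[OF g(1), of i j] ij by (auto simp: f_def)
    qed
  qed
  moreover have "f ` ?S \<subseteq> V"
  proof (rule image_subsetI)
    fix i assume i: "i \<in> ?S"
    show "f i \<in> V"
    proof (cases "i mod 4 = 1")
      case True
      then show ?thesis using i cA[of i] A(1) by (auto simp: f_def)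
    next
      case False
      then have "i \<in> ?I 0 \<union> ?I 2" using i by blast
      then show ?thesis using gR[of i] False by (simp add: f_def)
    qed
  qed
  moreover have "?S \<subseteq> {..<4 * k}" by auto
  ultimately have "\<exists>h. cycle_map V (4 * k) h \<and> (\<forall>i\<in>?S. h i = f i)"
    by (rule inj_on_extend) (rule assms)+
  then obtain h where h: "cycle_map V (4 * k) h" "\<forall>i\<in>?S. h i = f i"
    by (elim exE conjE)
  \<comment> \<open>An edge is indexed by its first position, so the edges of the two-edge paths
    have residues 0 and 1.\<close>
  have "2 * k = card (?I 0 \<union> ?I 1)"
    using card_residue_class[of 4 0 k] card_residue_class[of 4 1 k] by (subst card_Un_disjoint) auto
  also have "\<dots> \<le> red_count R (4 * k) h"
  proof (rule red_count_ge)
    fix i assume i: "i \<in> ?I 0 \<union> ?I 1"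
    then have "i < 4 * k" "i mod 4 = 0 \<or> i mod 4 = 1" by auto
    then have s: "Suc i mod (4 * k) = Suc i" "Suc i < 4 * k" "Suc i div 4 = i div 4"
      "Suc i mod 4 = Suc (i mod 4)"
      by (auto simp: Suc_mod_eq) presburger+
    then have "Suc i \<in> ?S" using i by auto
    then have "h (Suc i) = f (Suc i)" "h i = f i" using h(2) i by auto
    moreover have "{f i, f (Suc i)} \<in> R"
    proof (cases "i mod 4 = 0")
      case True
      then have "f (Suc i) = c (i div 4)" "f i = g i" using s by (auto simp: f_def)
      moreover have "i \<in> ?I 0 \<union> ?I 2" using i True by blast
      ultimately show ?thesis using gR[of i] by (simp add: insert_commute)
    next
      case False
      then have "f i = c (i div 4)" "f (Suc i) = g (Suc i)" "Suc i \<in> ?I 2"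
        using s i by (auto simp: f_def)
      then show ?thesis using gR[of "Suc i"] s by simp
    qed
    ultimately show "{h i, h (Suc i mod (4 * k))} \<in> R" using s by simp
  qed auto
  finally show ?thesis using h(1) by blast
qed

lemma matching_cycle:
  assumes "cycle_map V (2 * m) f" "\<And>j. j < m \<Longrightarrow> {f (2 * j), f (2 * j + 1)} \<in> R"
  shows "m \<le> red_count R (2 * m) f"
proof -
  have "m = card {i. i < 2 * m \<and> i mod 2 = 0}" by (simp add: card_residue_class)
  also have "\<dots> \<le> red_count R (2 * m) f"
  proof (rule red_count_ge)
    fix i assume "i \<in> {i. i < 2 * m \<and> i mod 2 = 0}"
    then obtain j where "i = 2 * j" "j < m" by (auto elim!: evenE simp: even_iff_mod_2_eq_zero[symmetric])
    then show "{f i, f (Suc i mod (2 * m))} \<in> R" using assms(2)[of j] by (simp add: Suc_mod_eq)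
  qed auto
  finally show ?thesis .
qed

lemma dense_cycle:
  assumes "finite V" "card V \<ge> 4 * k" "k > 0" "\<And>e. e \<in> R \<Longrightarrow> card e = 2 \<and> e \<subseteq> V"
    and big: "card R \<ge> (k - 1) * card V + 12 * k\<^sup>2"
  shows "\<exists>f. cycle_map V (4 * k) f \<and> 2 * k \<le> red_count R (4 * k) f"
proof -
  have finR: "finite R" using assms(1,4) by (meson finite_Pow_iff finite_subset PowI subsetI)
  let ?D = "\<lambda>v. card {e \<in> R. v \<in> e}"
  have deg: "?D v = card {w. {v, w} \<in> R}" for v
  proof -
    have "{e \<in> R. v \<in> e} = (\<lambda>w. {v, w}) ` {w. {v, w} \<in> R}"
    proof (intro set_eqI iffI)
      fix e assume e: "e \<in> {e \<in> R. v \<in> e}"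
      then obtain x y where "e = {x, y}" using assms(4) by (metis (no_types, lifting) card_2_iff mem_Collect_eq)
      then show "e \<in> (\<lambda>w. {v, w}) ` {w. {v, w} \<in> R}" using e by (auto simp: insert_commute)
    qed auto
    moreover have "inj_on (\<lambda>w. {v, w}) {w. {v, w} \<in> R}"
      by (auto simp: inj_on_def doubleton_eq_iff)
    ultimately show ?thesis by (simp add: card_image)
  qed
  have deg_V: "?D v \<le> card V" for v
    unfolding deg by (rule card_mono) (use assms(1,4) in auto)
  define B where "B = {v \<in> V. 3 * k - 1 \<le> ?D v}"
  show ?thesis
  proof (cases "card B \<ge> k")
    case True
    then obtain A where A: "A \<subseteq> B" "card A = k" by (meson obtain_subset_with_card_n)
    show ?thesis
      by (rule cherries_cycle[OF assms(1,2,4), where A = A]) (use A deg in \<open>auto simp: B_def\<close>)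
  next
    case False
    have finB: "finite B" using assms(1) by (simp add: B_def)
    define F where "F = {e \<in> R. e \<inter> B = {}}"
    have "R - F = (\<Union>v\<in>B. {e \<in> R. v \<in> e})" by (auto simp: F_def)
    then have "card (R - F) \<le> (\<Sum>v\<in>B. ?D v)" using finB by (simp add: card_UN_le)
    also have "\<dots> \<le> card B * card V" using sum_bounded_above[of B ?D "card V"] deg_V by simp
    also have "\<dots> \<le> (k - 1) * card V" using False by (intro mult_le_mono1) simp
    finally have "card (R - F) \<le> (k - 1) * card V" .
    moreover have "card (R - F) = card R - card F"
      using finR by (intro card_Diff_subset) (auto simp: F_def)
    ultimately have cF: "12 * k\<^sup>2 \<le> card F" using big by linarith
    have dF: "card {e \<in> F. v \<in> e} \<le> 3 * k - 2" for v
    proof (cases "v \<in> V - B")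
      case True
      have "card {e \<in> F. v \<in> e} \<le> ?D v" using finR by (intro card_mono) (auto simp: F_def)
      then show ?thesis using True by (auto simp: B_def)
    next
      case False
      then have "{e \<in> F. v \<in> e} = {}" using assms(4) by (auto simp: F_def)
      then show ?thesis by (simp only: card.empty)
    qed
    \<comment> \<open>This is the constant in the hypothesis: a greedy matching of size
      \<open>2 * k\<close> under maximum degree \<open>3 * k - 2\<close> needs fewer than
      \<open>12 * k\<^sup>2\<close> edges to start from.\<close>
    have "2 * (3 * k - 2) * (2 * k) < 2 * (3 * k) * (2 * k)" using assms(3) by simp
    also have "\<dots> = 12 * k\<^sup>2" by (simp add: power2_eq_square)
    finally have "2 * (3 * k - 2) * (2 * k) < card F" using cF by (rule less_le_trans)
    then obtain f where f: "cycle_map V (2 * (2 * k)) f" "\<forall>j<2 * k. {f (2 * j), f (2 * j + 1)} \<in> F"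
      using matching_exists[of F V "3 * k - 2" "2 * k"] dF finR assms(4) by (auto simp: F_def)
    then have "2 * k \<le> red_count R (2 * (2 * k)) f"
      by (intro matching_cycle) (auto simp: F_def)
    with f show ?thesis by (auto simp: mult.assoc[symmetric])
  qed
qed

section \<open>Balanced copies of a cycle\<close>

definition cycle_edge :: "nat \<Rightarrow> (nat \<Rightarrow> 'a) \<Rightarrow> nat \<Rightarrow> 'a set" where
  "cycle_edge l f i = {f i, f (Suc i mod l)}"

lemma image_edges_cycle_graph:
  "(`) f ` edges (cycle_graph l) = cycle_edge l f ` {..<l}"
  by (auto simp: cycle_graph_def cycle_edge_def image_iff) blast+

text \<open>Two positions with the same edge would have to be each other's successors, which happens
  only when \<open>l = 2\<close>. Injectivity turns counts of positions into counts of
  edges.\<close>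

lemma inj_on_cycle_edge:
  assumes "inj_on f {..<l}" "3 \<le> l"
  shows "inj_on (cycle_edge l f) {..<l}"
proof (rule inj_onI)
  fix i j assume ij: "i \<in> {..<l}" "j \<in> {..<l}" and eq: "cycle_edge l f i = cycle_edge l f j"
  have "f i = f j \<or> f i = f (Suc j mod l) \<and> f (Suc i mod l) = f j"
    using eq by (auto simp: cycle_edge_def doubleton_eq_iff)
  then have "i = j \<or> i = Suc j mod l \<and> Suc i mod l = j"
    using assms ij by (auto dest!: inj_onD[OF assms(1)])
  then show "i = j" using assms(2) ij by (auto simp: Suc_mod_eq split: if_splits)
qed

lemma red_count_eq_card: "red_count R l f = card {i. i < l \<and> cycle_edge l f i \<in> R}"
proof -
  have "{..<l} \<inter> {i. cycle_edge l f i \<in> R} = {i. i < l \<and> cycle_edge l f i \<in> R}" by auto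
  then show ?thesis by (simp add: red_count_def cycle_edge_def)
qed

lemma cycle_edge_complete:
  assumes "cycle_map {..<n} l f" "2 \<le> l" "i < l"
  shows "cycle_edge l f i \<in> edges (complete_graph n)"
proof -
  have "Suc i mod l < l" "Suc i mod l \<noteq> i" using assms by (auto simp: Suc_mod_eq)
  moreover from this have "f i \<noteq> f (Suc i mod l)"
    using assms unfolding cycle_map_def by (auto dest: inj_onD)
  moreover have "f j < n" if "j < l" for j using assms(1) that by (auto simp: cycle_map_def)
  ultimately show ?thesis using assms(3) by (auto simp: complete_graph_def cycle_edge_def)
qed

lemma has_balanced_copy_cycle:
  assumes col: "two_coloring n R B" and f: "cycle_map {..<n} (2 * t) f"
    and t: "red_count R (2 * t) f = t" "2 \<le> t"
  shows "has_balanced_copy n (cycle_graph (2 * t)) R B"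
proof -
  let ?e = "cycle_edge (2 * t) f"
  let ?C = "(f ` {..<2 * t}, (`) f ` edges (cycle_graph (2 * t)))"
  have sub: "?e ` {..<2 * t} \<subseteq> edges (complete_graph n)"
    using cycle_edge_complete[OF f] t(2) by auto
  have copy: "?C \<in> copies (cycle_graph (2 * t)) (complete_graph n)"
    unfolding copies_def
    using f sub image_edges_cycle_graph[of f "2 * t"]
    by (intro CollectI exI[of _ f]) (auto simp: cycle_map_def cycle_graph_def complete_graph_def)
  have inj: "inj_on ?e {..<2 * t}"
    using f t(2) by (intro inj_on_cycle_edge) (auto simp: cycle_map_def)
  let ?I = "{i. i < 2 * t \<and> ?e i \<in> R}" and ?J = "{i. i < 2 * t \<and> ?e i \<notin> R}"
  have IJ: "?I \<union> ?J = {..<2 * t}" "?I \<inter> ?J = {}" by auto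
  then have "card ?I + card ?J = 2 * t"
    using card_Un_disjoint[of ?I ?J] by simp
  moreover have "card ?I = t" using t(1) by (simp add: red_count_eq_card)
  moreover have "card (?e ` ?I) = card ?I" "card (?e ` ?J) = card ?J"
    by (rule card_image, rule inj_on_subset[OF inj], auto)+
  moreover have "?e ` ?J \<subseteq> B" using sub col by (auto simp: two_coloring_def)
  moreover have "?e ` ?I \<union> ?e ` ?J = edges ?C"
    unfolding image_Un[symmetric] IJ by (simp add: image_edges_cycle_graph)
  ultimately have "balanced R B ?C"
    unfolding balanced_def by (intro exI[of _ "?e ` ?I"] exI[of _ "?e ` ?J"]) auto
  with copy show ?thesis by (auto simp: has_balanced_copy_def)
qed

text \<open>Density gives one cycle with at least \<open>2 * k\<close> red edges and another with at
  least \<open>2 * k\<close> blue, hence at most \<open>2 * k\<close> red ones. If the value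
  \<open>2 * k\<close> is never attained, these lie on opposite sides of it, contradicting
  \<open>red_count_connected\<close>.\<close>

lemma dense_coloring_balanced:
  assumes col: "two_coloring n R B" and "k > 0" "n \<ge> 4 * k + 2"
    and R: "card R \<ge> (k - 1) * n + 12 * k\<^sup>2" and B: "card B \<ge> (k - 1) * n + 12 * k\<^sup>2"
  shows "has_balanced_copy n (cycle_graph (4 * k)) R B"
proof (rule ccontr)
  assume neg: "\<not> ?thesis"
  have l: "4 * k = 2 * (2 * k)" by simp
  have avoid: "red_count R (4 * k) g \<noteq> 2 * k" if "cycle_map {..<n} (4 * k) g" for g
    using has_balanced_copy_cycle[OF col, of "2 * k" g] that neg \<open>k > 0\<close> unfolding l by auto
  have RB: "card e = 2 \<and> e \<subseteq> {..<n}" if "e \<in> R \<union> B" for e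
    using col that by (auto simp: two_coloring_def complete_graph_def)
  obtain f where f: "cycle_map {..<n} (4 * k) f" "2 * k \<le> red_count R (4 * k) f"
    using dense_cycle[of "{..<n}" k R] RB R assms(2,3) by auto
  obtain g where g: "cycle_map {..<n} (4 * k) g" "2 * k \<le> red_count B (4 * k) g"
    using dense_cycle[of "{..<n}" k B] RB B assms(2,3) by auto
  have "R \<inter> B = {}" using col by (simp add: two_coloring_def)
  then have "red_count R (4 * k) g + red_count B (4 * k) g \<le> (\<Sum>i<4 * k. 1)"
    unfolding red_count_def sum.distrib[symmetric] by (intro sum_mono) auto
  then have "red_count R (4 * k) g < 2 * k" using g avoid[OF g(1)] by simp
  then have "red_count R (4 * k) f < 2 * k"
    using red_count_connected[of "4 * k" "2 * k" "{..<n}" R f g] avoid f g assms(2,3) by auto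
  then show False using f by simp
qed

text \<open>A cycle passes through each vertex of \<open>A\<close> at most once and uses two edges
  there, so it has fewer than \<open>2 * k\<close> edges meeting \<open>A\<close>, whereas a
  balanced copy needs \<open>2 * k\<close> edges from \<open>R\<close>.\<close>

lemma no_balanced_copy_cover:
  assumes "\<And>e. e \<in> R \<Longrightarrow> e \<inter> A \<noteq> {}" "finite A" "card A < k"
  shows "\<not> has_balanced_copy n (cycle_graph (4 * k)) R B"
proof
  assume "has_balanced_copy n (cycle_graph (4 * k)) R B"
  then obtain f E1 E2 where f: "inj_on f {..<4 * k}"
    and E: "E1 \<union> E2 = (`) f ` edges (cycle_graph (4 * k))" "E1 \<inter> E2 = {}" "E1 \<subseteq> R"
      "\<bar>int (card E1) - int (card E2)\<bar> \<le> 1"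
    unfolding has_balanced_copy_def copies_def balanced_def by (auto simp: cycle_graph_def)
  let ?e = "cycle_edge (4 * k) f"
  have E': "E1 \<union> E2 = ?e ` {..<4 * k}" using E(1) image_edges_cycle_graph by simp
  have "inj_on ?e {..<4 * k}" using f assms(3) by (intro inj_on_cycle_edge) auto
  then have "card (E1 \<union> E2) = 4 * k" unfolding E' by (simp add: card_image)
  moreover have "finite (E1 \<union> E2)" unfolding E' by simp
  ultimately have "card E1 + card E2 = 4 * k" using E(2) by (simp add: card_Un_disjoint)
  then have "2 * k \<le> card E1" using E(4) by linarith
  \<comment> \<open>Edges touching \<open>A\<close> by their first and by their second endpoint;
    each kind injects into \<open>A\<close>.\<close>
  let ?I = "{i. i < 4 * k \<and> f i \<in> A}" and ?J = "{i. i < 4 * k \<and> f (Suc i mod (4 * k)) \<in> A}"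
  have "E1 \<subseteq> ?e ` (?I \<union> ?J)"
  proof
    fix e assume e: "e \<in> E1"
    then obtain i where i: "i < 4 * k" "e = ?e i" using E' by auto
    then have "?e i \<inter> A \<noteq> {}" using e E(3) assms(1) by auto
    then show "e \<in> ?e ` (?I \<union> ?J)" using i by (auto simp: cycle_edge_def)
  qed
  then have "card E1 \<le> card (?e ` (?I \<union> ?J))" by (intro card_mono) auto
  also have "\<dots> \<le> card (?I \<union> ?J)" by (rule card_image_le) simp
  also have "\<dots> \<le> card ?I + card ?J" by (rule card_Un_le)
  finally have "card E1 \<le> card ?I + card ?J" .
  moreover have "card ?I \<le> card A"
    using f by (intro card_inj_on_le[of f] assms(2)) (auto simp: inj_on_def)
  moreover have "card ?J \<le> card A"
  proof (intro card_inj_on_le[of "\<lambda>i. f (Suc i mod (4 * k))"] assms(2) inj_onI)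
    fix i j assume ij: "i \<in> ?J" "j \<in> ?J" "f (Suc i mod (4 * k)) = f (Suc j mod (4 * k))"
    have "Suc i mod (4 * k) = Suc j mod (4 * k)"
      by (rule inj_onD[OF f ij(3)]) (use ij in auto)
    then show "i = j" using ij by (auto simp: Suc_mod_eq split: if_splits)
  qed auto
  ultimately show False using \<open>2 * k \<le> card E1\<close> assms(3) by linarith
qed

section \<open>Colorings, list colorings and their thresholds\<close>

lemma finite_edges_complete_graph: "finite (edges (complete_graph n))"
  by (simp add: complete_graph_def)

lemma card_edges_complete_graph: "card (edges (complete_graph n)) = n choose 2"
  by (simp add: complete_graph_def n_subsets)

lemma card_crossing_edges:
  assumes "a \<le> n"
  shows "card {e \<in> edges (complete_graph n). e \<inter> {..<a} \<noteq> {} \<and> \<not> e \<subseteq> {..<a}} = a * (n - a)"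
proof -
  have "{e \<in> edges (complete_graph n). e \<inter> {..<a} \<noteq> {} \<and> \<not> e \<subseteq> {..<a}} =
      (\<lambda>(x, y). {x, y}) ` ({..<a} \<times> {a..<n})" (is "?L = ?R")
  proof (intro set_eqI iffI)
    fix e assume e: "e \<in> ?L"
    then obtain x y where xy: "x \<in> e" "x < a" "y \<in> e" "\<not> y < a" by auto
    obtain u v where "e = {u, v}" using e by (auto simp: complete_graph_def card_2_iff)
    then have "e = {x, y}" using xy by auto
    then show "e \<in> ?R" using e xy by (auto simp: complete_graph_def)
  next
    fix e assume "e \<in> ?R"
    then obtain x y where "e = {x, y}" "x < a" "a \<le> y" "y < n" by auto
    then show "e \<in> ?L" by (auto simp: complete_graph_def)
  qed
  moreover have "inj_on (\<lambda>(x, y). {x, y}) ({..<a} \<times> {a..<n})"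
    by (auto simp: inj_on_def doubleton_eq_iff)
  ultimately show ?thesis by (simp add: card_image)
qed

text \<open>This is \<open>bal_threshold\<close> without its satisfiability condition, the form
  implied by both kinds of threshold.\<close>

definition forces_balanced :: "nat \<Rightarrow> 'a sgraph \<Rightarrow> int \<Rightarrow> bool" where
  "forces_balanced n G m \<longleftrightarrow>
     (\<forall>R B. two_coloring n R B \<and> int (card R) > m \<and> int (card B) > m \<longrightarrow>
        has_balanced_copy n G R B)"

lemma two_coloring_subset:
  "X \<subseteq> edges (complete_graph n) \<Longrightarrow> two_coloring n X (edges (complete_graph n) - X)"
  by (auto simp: two_coloring_def)

lemma two_coloring_card:
  assumes "two_coloring n R B"
  shows "card R + card B = n choose 2"
proof -
  have "finite (R \<union> B)" using assms finite_edges_complete_graph by (simp add: two_coloring_def)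
  then show ?thesis
    using assms card_edges_complete_graph[of n] card_Un_disjoint[of R B]
    by (simp add: two_coloring_def)
qed

lemma lbal_threshold_imp_forces_balanced:
  assumes "lbal_threshold n G m"
  shows "forces_balanced n G m"
  unfolding forces_balanced_def
proof (intro allI impI, elim conjE)
  fix R B assume col: "two_coloring n R B" and card: "int (card R) > m" "int (card B) > m"
  define L where "L = (\<lambda>e. if e \<in> R then {Red} else {Blue})"
  have "color_class n L Red = R" "color_class n L Blue = B"
    using col by (auto simp: two_coloring_def color_class_def L_def)
  moreover have "two_list_coloring n L" by (simp add: two_list_coloring_def L_def)
  ultimately show "has_balanced_copy n G R B"
    using assms card unfolding lbal_threshold_def by metis
qed

lemma has_balanced_copy_mono:
  assumes "has_balanced_copy n G R B" "R \<subseteq> R'" "B \<subseteq> B'"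
  shows "has_balanced_copy n G R' B'"
  using assms unfolding has_balanced_copy_def balanced_def by (meson subset_trans)

text \<open>Since \<open>2 (m + 1) \<le> n choose 2\<close>, the two-colored edges can be split between the
  classes so that both stay larger than \<open>m\<close>.\<close>

lemma bal_threshold_imp_lbal_threshold:
  assumes "bal_threshold n G m"
  shows "lbal_threshold n G m"
  unfolding lbal_threshold_def
proof (intro allI impI, elim conjE)
  fix L assume L: "two_list_coloring n L"
    and card: "int (card (color_class n L Red)) > m" "int (card (color_class n L Blue)) > m"
  let ?E = "edges (complete_graph n)"
  let ?R = "color_class n L Red" and ?B = "color_class n L Blue"
  have RB: "?R \<union> ?B = ?E" using L by (auto simp: two_list_coloring_def color_class_def)
  then have sub: "?E - ?B \<subseteq> ?R" "?R \<subseteq> ?E" "?B \<subseteq> ?E" by auto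
  have fin: "finite ?R" "finite ?B" using sub finite_edges_complete_graph finite_subset by blast+
  have "card (?E - ?B) = (n choose 2) - card ?B"
    using card_edges_complete_graph card_Diff_subset[OF fin(2) sub(3)] by simp
  moreover have "card ?B \<le> n choose 2"
    using card_mono[OF finite_edges_complete_graph sub(3)] card_edges_complete_graph by simp
  moreover have "2 * (m + 1) \<le> int (n choose 2)" using assms by (simp add: bal_threshold_def)
  moreover have "card (?E - ?B) \<le> card ?R" using sub fin by (intro card_mono)
  ultimately obtain s where s: "card (?E - ?B) \<le> s" "s \<le> card ?R"
      "int s > m" "int (n choose 2) - int s > m"
    \<comment> \<open>With \<open>s\<close> equal to the first argument the other class has size
      \<open>card ?B\<close>; with the second it keeps at least \<open>m + 1\<close> edges by the
      condition \<open>2 * (m + 1) \<le> int (n choose 2)\<close>.\<close>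
    using card that[of "max (card (?E - ?B)) (nat (m + 1))"] by fastforce
  obtain X where X: "?E - ?B \<subseteq> X" "X \<subseteq> ?R" "card X = s"
    using exists_subset_between[OF s(1,2) sub(1) fin(1)] by blast
  have col: "two_coloring n X (?E - X)" using X sub by (intro two_coloring_subset) auto
  have "int (card (?E - X)) > m" using two_coloring_card[OF col] X(3) s(4) by linarith
  then have "has_balanced_copy n G X (?E - X)"
    using assms col X(3) s(3) unfolding bal_threshold_def by blast
  then show "has_balanced_copy n G ?R ?B"
    by (rule has_balanced_copy_mono) (use X in auto)
qed

text \<open>The lower bound \<open>a\<close> shifts the predicate to the naturals, where a least
  witness exists.\<close>

lemma int_least_exists:
  fixes P :: "int \<Rightarrow> bool"
  assumes "P m" "\<And>j. P j \<Longrightarrow> a \<le> j"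
  shows "\<exists>b. P b \<and> (\<forall>j. P j \<longrightarrow> b \<le> j)"
proof -
  have "P (a + int (nat (m - a)))" using assms by simp
  then obtain s where s: "P (a + int s)" "\<And>r. P (a + int r) \<Longrightarrow> s \<le> r"
    using LeastI[of "\<lambda>r. P (a + int r)"] Least_le[of "\<lambda>r. P (a + int r)"] by blast
  have "a + int s \<le> j" if "P j" for j
  proof -
    have "P (a + int (nat (j - a)))" using that assms(2)[OF that] by simp
    then have "s \<le> nat (j - a)" by (rule s(2))
    then show ?thesis using assms(2)[OF that] by linarith
  qed
  then show ?thesis using s(1) by blast
qed

section \<open>The two bounds and the equality\<close>

text \<open>The red edges between \<open>k - 1\<close> vertices and the rest are covered by those
  vertices, so no balanced cycle exists. The assumption \<open>half\<close> makes blue at least as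
  large as red, so both classes would exceed any smaller \<open>m\<close>.\<close>

lemma forces_balanced_cycle_ge:
  assumes "forces_balanced n (cycle_graph (4 * k)) m" "k > 0" "k \<le> n"
    and half: "2 * ((k - 1) * (n - (k - 1))) \<le> n choose 2"
  shows "int ((k - 1) * (n - (k - 1))) \<le> m"
proof (rule ccontr)
  assume m: "\<not> ?thesis"
  define R where "R = {e \<in> edges (complete_graph n). e \<inter> {..<k - 1} \<noteq> {} \<and> \<not> e \<subseteq> {..<k - 1}}"
  let ?B = "edges (complete_graph n) - R"
  have col: "two_coloring n R ?B" by (rule two_coloring_subset) (auto simp: R_def)
  have cR: "card R = (k - 1) * (n - (k - 1))"
    unfolding R_def using assms(3) by (intro card_crossing_edges) simp
  have "card R \<le> card ?B" using two_coloring_card[OF col] half cR by linarith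
  then have "has_balanced_copy n (cycle_graph (4 * k)) R ?B"
    using assms(1) col cR m unfolding forces_balanced_def
    by (smt (verit, best) of_nat_mono)
  moreover have "\<not> has_balanced_copy n (cycle_graph (4 * k)) R ?B"
    by (rule no_balanced_copy_cover[of _ "{..<k - 1}"]) (use assms(2) in \<open>auto simp: R_def\<close>)
  ultimately show False by simp
qed

lemma theorem9_size_bounds:
  assumes "k > 0" "real n \<ge> 9 / 2 * real k ^ 2 + 13 / 4 * real k + 49 / 32"
  shows "4 * k + 2 \<le> n" "2 * ((k - 1) * n + 12 * k\<^sup>2 + 3 * k) \<le> n choose 2"
proof -
  define x where "x = real k"
  have x: "1 \<le> x" using assms(1) by (simp add: x_def)
  have sq: "2 * x - 1 \<le> x\<^sup>2" using sum_squares_ge_zero[of "x - 1" 0]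
    by (simp add: power2_eq_square algebra_simps)
  have n: "9 / 2 * x\<^sup>2 + 13 / 4 * x + 49 / 32 \<le> real n" using assms(2) by (simp add: x_def)
  have "x \<le> x\<^sup>2" using x sq by linarith
  then have n1: "31 / 4 * x + 1 \<le> real n" using n by linarith
  then have "4 * x + 2 \<le> real n" using x by linarith
  then show "4 * k + 2 \<le> n" unfolding x_def by linarith
  \<comment> \<open>The target
    \<open>4 * ((x - 1) * n + 12 * x\<^sup>2 + 3 * x) \<le> n * (n - 1)\<close> rearranges to
    \<open>48 * x\<^sup>2 + 12 * x \<le> n * (n - 4 * x + 3)\<close>, so each factor is bounded
    below by a multiple of \<open>x\<close>.\<close>
  have n2: "33 / 4 * x \<le> real n - 4 * x + 3" using n sq by linarith
  have "(31 / 4 * x) * (33 / 4 * x) \<le> real n * (real n - 4 * x + 3)"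
    using n1 n2 x by (intro mult_mono) auto
  moreover have "48 * x\<^sup>2 + 12 * x \<le> 60 * x\<^sup>2" using \<open>x \<le> x\<^sup>2\<close> by linarith
  moreover have "60 * x\<^sup>2 \<le> (31 / 4 * x) * (33 / 4 * x)" by (simp add: power2_eq_square)
  ultimately have "4 * ((x - 1) * real n + 12 * x\<^sup>2 + 3 * x) \<le> real n * (real n - 1)"
    by (simp add: algebra_simps)
  also have "real n * (real n - 1) = real (n * (n - 1))"
    using n1 x by (cases n) (auto simp: algebra_simps)
  finally have "4 * ((x - 1) * real n + 12 * x\<^sup>2 + 3 * x) \<le> real (n * (n - 1))" .
  moreover have "x - 1 = real (k - 1)" using assms(1) by (simp add: x_def)
  ultimately have "real (4 * ((k - 1) * n + 12 * k\<^sup>2 + 3 * k)) \<le> real (n * (n - 1))"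
    by (simp only: of_nat_mult of_nat_add of_nat_power of_nat_numeral x_def)
  then have "4 * ((k - 1) * n + 12 * k\<^sup>2 + 3 * k) \<le> n * (n - 1)"
    by (simp only: of_nat_le_iff)
  then show "2 * ((k - 1) * n + 12 * k\<^sup>2 + 3 * k) \<le> n choose 2"
    unfolding choose_two by linarith
qed

theorem theorem9:
  fixes k n :: nat
  assumes "k > 0"
    and "real n \<ge> 9 / 2 * real k ^ 2 + 13 / 4 * real k + 49 / 32"
  shows "bal_exists n (cycle_graph (4 * k)) \<and> lbal_exists n (cycle_graph (4 * k)) \<and>
    (int k - 1) * int n - (int k - 1) ^ 2 \<le> lbal n (cycle_graph (4 * k)) \<and>
    lbal n (cycle_graph (4 * k)) = bal n (cycle_graph (4 * k)) \<and>
    bal n (cycle_graph (4 * k)) < (int k - 1) * int n + 12 * int k ^ 2 + 3 * int k"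
proof -
  let ?G = "cycle_graph (4 * k)"
  define M where "M = (k - 1) * n + 12 * k\<^sup>2 + 3 * k"
  define a where "a = (k - 1) * (n - (k - 1))"
  note size = theorem9_size_bounds[OF assms, folded M_def]
  have bal_iff: "bal_threshold n ?G m \<longleftrightarrow> 2 * (m + 1) \<le> int (n choose 2) \<and> forces_balanced n ?G m"
    for m by (simp add: bal_threshold_def forces_balanced_def)
  \<comment> \<open>This lets the size bound for \<open>M\<close> supply the assumption
    \<open>half\<close> of the lower bound.\<close>
  have "a \<le> M" unfolding a_def M_def add.assoc by (intro trans_le_add1 mult_le_mono2) simp
  then have lower: "int a \<le> m" if "forces_balanced n ?G m" for m
    using forces_balanced_cycle_ge[OF that assms(1)] size by (simp add: a_def)
  have "has_balanced_copy n ?G R B"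
    if "two_coloring n R B" "int (card R) > int M - 1" "int (card B) > int M - 1" for R B
  proof (rule dense_coloring_balanced[OF that(1) assms(1) size(1)])
    have "M \<le> card R" "M \<le> card B" using that(2,3) by linarith+
    then show "(k - 1) * n + 12 * k\<^sup>2 \<le> card R" "(k - 1) * n + 12 * k\<^sup>2 \<le> card B"
      unfolding M_def by linarith+
  qed
  then have "forces_balanced n ?G (int M - 1)" by (simp add: forces_balanced_def)
  then have M: "bal_threshold n ?G (int M - 1)" using size(2) by (simp add: bal_iff)
  obtain b where b: "bal_threshold n ?G b" "\<And>m. bal_threshold n ?G m \<Longrightarrow> b \<le> m"
    using int_least_exists[of "bal_threshold n ?G" "int M - 1" "int a"] M lower bal_iff by blast
  have lb: "lbal_threshold n ?G b" using b(1) by (rule bal_threshold_imp_lbal_threshold)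
  have lb_least: "b \<le> m" if "lbal_threshold n ?G m" for m
  proof (rule ccontr)
    assume "\<not> b \<le> m"
    \<comment> \<open>The satisfiability condition is inherited downwards from \<open>b\<close>, so
      a list threshold below \<open>b\<close> would also be a threshold for ordinary
      colorings.\<close>
    then have "bal_threshold n ?G m"
      using b(1) lbal_threshold_imp_forces_balanced[OF that] by (auto simp: bal_iff)
    then show False using b(2) \<open>\<not> b \<le> m\<close> by blast
  qed
  have "bal n ?G = b" unfolding bal_def using b by (intro Least_equality)
  moreover have "lbal n ?G = b" unfolding lbal_def using lb lb_least by (intro Least_equality)
  moreover have "bal_exists n ?G" using b by (auto simp: bal_exists_def)
  moreover have "lbal_exists n ?G"
    using lb lb_least size(1) by (auto simp: lbal_exists_def cycle_graph_def)
  moreover have "int a = (int k - 1) * int n - (int k - 1) ^ 2"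
  proof -
    have "int (k - 1) = int k - 1" "int (n - (k - 1)) = int n - (int k - 1)"
      using assms(1) size(1) by linarith+
    then have "int a = (int k - 1) * (int n - (int k - 1))" by (simp only: a_def of_nat_mult)
    then show ?thesis by (simp only: right_diff_distrib power2_eq_square)
  qed
  moreover have "int a \<le> b" using lower b(1) bal_iff by blast
  moreover have "int M = (int k - 1) * int n + 12 * int k ^ 2 + 3 * int k"
    using assms(1) by (simp add: M_def of_nat_diff)
  moreover have "b < int M" using b(2)[OF M] by simp
  ultimately show ?thesis by simp
qed

end
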